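(* Let $G$ be a graph with vertex set $V(G)$ and adjacency matrix $A(G)$, let $P=\{E_i \mid i\in I\}$ be an edge clique partition of $G$, let $m=m_G(P)$ and $m_v=m_v(P)$ for every $v\in V(G)$. Then: 1. Every eigenvalue $\mu$ of $G$ satisfies $\mu \ge -m$. 2. $-m$ is an eigenvalue of $G$ if and only if there exists a vector $X=(x_v)_{v\in V(G)}\neq \mathbf{0}$ such that (a) $\sum_{j\in V(G[E_i])} x_j=0$ for every $i\in I$, and (b) for every $v\in V(G)$, $x_v=0$ whenever $m_v\neq m$. In the positive case, any such $X$ is an eigenvector of $A(G)$ associated with the eigenvalue $-m$.
   Context: All graphs are simple and undirected; eigenvalues of $G$ are those of its adjacency matrix. An edge clique partition (ECP) of $G$ is a partition $P=\{E_i\mid i\in I\}$ of $E(G)$ such that for each $i$ the set $V(G[E_i])$ of end-vertices of edges in $E_i$ is a clique of $G$ and $E_i$ is exactly the set of edges joining vertices of this clique. The clique degree $m_v(P)$ is the number of $i\in I$ with $v\in V(G[E_i])$, and $m_G(P)=\max_{v\in V(G)} m_v(P)$. *)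

theory Defs
  imports "HOL-Analysis.Analysis" "HOL-Library.Disjoint_Sets"
begin

text \<open>
  A finite simple undirected graph is given by its set of edges, each edge being the
  two-element set of its end-vertices. The vertex set is the whole (finite, nonempty) type
  \<open>'v\<close>, so isolated vertices are allowed.
\<close>

definition simple_graph :: "'v set set \<Rightarrow> bool" where
  "simple_graph E \<longleftrightarrow> (\<forall>e\<in>E. card e = 2)"

definition clique :: "'v set set \<Rightarrow> 'v set \<Rightarrow> bool" where
  "clique E K \<longleftrightarrow> (\<forall>u\<in>K. \<forall>v\<in>K. u \<noteq> v \<longrightarrow> {u, v} \<in> E)"

definition end_vertices :: "'v set set \<Rightarrow> 'v set" where
  "end_vertices F = \<Union>F"

text \<open>
  The blocks of a partition are nonempty and pairwise distinct, so the set of blocks serves as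
  its own index set.
\<close>

definition edge_clique_partition :: "'v set set \<Rightarrow> 'v set set set \<Rightarrow> bool" where
  "edge_clique_partition E P \<longleftrightarrow>
     partition_on E P \<and>
     (\<forall>F\<in>P. clique E (end_vertices F) \<and> F = {e \<in> E. e \<subseteq> end_vertices F})"

definition clique_degree :: "'v set set set \<Rightarrow> 'v \<Rightarrow> nat" where
  "clique_degree P v = card {F \<in> P. v \<in> end_vertices F}"

definition max_clique_degree :: "'v::finite set set set \<Rightarrow> nat" where
  "max_clique_degree P = Max (range (clique_degree P))"

definition adjacency_matrix :: "'v::finite set set \<Rightarrow> real ^ 'v ^ 'v" where
  "adjacency_matrix E = (\<chi> u v. if {u, v} \<in> E then 1 else 0)"

text \<open>
  Eigenvalues are taken over the reals: adjacency matrices are real symmetric, so they have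
  no other complex eigenvalues.
\<close>

definition eigenvector :: "real ^ 'n ^ 'n \<Rightarrow> real ^ 'n \<Rightarrow> real \<Rightarrow> bool" where
  "eigenvector A x \<mu> \<longleftrightarrow> x \<noteq> 0 \<and> A *v x = \<mu> *\<^sub>R x"

definition eigenvalue :: "real ^ 'n ^ 'n \<Rightarrow> real \<Rightarrow> bool" where
  "eigenvalue A \<mu> \<longleftrightarrow> (\<exists>x. eigenvector A x \<mu>)"

end

theory Submission
  imports Defs
begin

text \<open>
  If \<open>N\<close> is the incidence matrix between vertices and the cliques of \<open>P\<close>, then
  \<open>A + diag (m\<^sub>v) = N N\<^sup>T\<close>, because two distinct vertices lie together in exactly one clique if
  they are adjacent and in none otherwise. Hence an eigenvector \<open>x\<close> for \<open>\<mu>\<close> satisfies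
  \<open>(\<mu> + m) (x \<bullet> x) = \<Sum>\<^sub>F (\<Sum>\<^sub>j x\<^sub>j)\<^sup>2 + \<Sum>\<^sub>v (m - m\<^sub>v) x\<^sub>v\<^sup>2 \<ge> 0\<close>, and both sums vanish when \<open>\<mu> = -m\<close>.
\<close>

abbreviation clique_sum :: "real ^ 'v::finite \<Rightarrow> 'v set set \<Rightarrow> real" where
  "clique_sum x F \<equiv> \<Sum>j\<in>end_vertices F. x $ j"

text \<open>A block whose clique contains two distinct vertices must contain the edge joining them.
  The blocks are disjoint with union \<open>E\<close>, so that edge lies in exactly one block if it
  is in \<open>E\<close>, and in none otherwise.\<close>

lemma card_cliques_containing_pair:
  fixes E :: "'v::finite set set"
  assumes "edge_clique_partition E P" and "u \<noteq> v"
  shows "card {F \<in> P. u \<in> end_vertices F \<and> v \<in> end_vertices F} = of_bool ({u, v} \<in> E)"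
proof -
  have P: "\<Union>P = E" "disjoint P"
    and C: "\<And>F. F \<in> P \<Longrightarrow> clique E (end_vertices F) \<and> F = {e \<in> E. e \<subseteq> end_vertices F}"
    using assms(1) by (auto simp: edge_clique_partition_def partition_on_def)
  \<comment> \<open>The clique property puts \<open>{u, v}\<close> in \<open>E\<close>; that
    \<open>F\<close> consists of all edges inside its clique then puts it in
    \<open>F\<close>.\<close>
  have iff: "u \<in> end_vertices F \<and> v \<in> end_vertices F \<longleftrightarrow> {u, v} \<in> F" if "F \<in> P" for F
  proof
    assume uv: "u \<in> end_vertices F \<and> v \<in> end_vertices F"
    then have "{u, v} \<in> E"
      using C[OF that] \<open>u \<noteq> v\<close> by (auto simp: clique_def)
    then have "{u, v} \<in> {e \<in> E. e \<subseteq> end_vertices F}"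
      using uv by simp
    then show "{u, v} \<in> F"
      using C[OF that] by blast
  qed (auto simp: end_vertices_def)
  then have eq: "{F \<in> P. u \<in> end_vertices F \<and> v \<in> end_vertices F} = {F \<in> P. {u, v} \<in> F}"
    by blast
  show ?thesis
  proof (cases "{u, v} \<in> E")
    case True
    then obtain F where F: "F \<in> P" "{u, v} \<in> F"
      using P(1) by blast
    then have "{F \<in> P. {u, v} \<in> F} = {F}"
      using P(2) by (auto dest: disjointD)
    then show ?thesis
      unfolding eq using True by simp
  next
    case False
    then have "{F \<in> P. {u, v} \<in> F} = {}"
      using P(1) by blast
    then show ?thesis
      unfolding eq using False by simp
  qed
qed

text \<open>Coordinate \<open>u\<close> of \<open>A x = N N\<^sup>T x - diag (m\<^sub>v) x\<close>.
  When the clique sums over the blocks at \<open>u\<close> are expanded and the order of summation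
  exchanged, \<open>x $ v\<close> is counted once for each block containing both \<open>u\<close>
  and \<open>v\<close>.\<close>

lemma adjacency_matrix_mult_vec:
  fixes E :: "'v::finite set set" and x :: "real ^ 'v"
  assumes "simple_graph E" and "edge_clique_partition E P"
  shows "(adjacency_matrix E *v x) $ u =
    (\<Sum>F | F \<in> P \<and> u \<in> end_vertices F. clique_sum x F) - real (clique_degree P u) * x $ u"
proof -
  \<comment> \<open>The \<open>(u, v)\<close> entry of \<open>N N\<^sup>T\<close>. On the diagonal
    the adjacency term is 0, since \<open>{u, u}\<close> is a singleton and edges have two
    elements.\<close>
  have entry: "real (card {F \<in> P. u \<in> end_vertices F \<and> v \<in> end_vertices F}) =
      adjacency_matrix E $ u $ v + (if v = u then real (clique_degree P u) else 0)" for v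
  proof (cases "v = u")
    case True
    have "{u} \<notin> E"
      using assms(1) by (auto simp: simple_graph_def)
    with True show ?thesis
      by (simp add: adjacency_matrix_def clique_degree_def)
  next
    case False
    then show ?thesis
      using card_cliques_containing_pair[OF assms(2), of u v] by (simp add: adjacency_matrix_def)
  qed
  have "(\<Sum>F | F \<in> P \<and> u \<in> end_vertices F. clique_sum x F) =
      (\<Sum>F | F \<in> P \<and> u \<in> end_vertices F. \<Sum>v | v \<in> UNIV \<and> v \<in> end_vertices F. x $ v)"
    by simp
  also have "\<dots> = (\<Sum>v\<in>UNIV. \<Sum>F | F \<in> {F. F \<in> P \<and> u \<in> end_vertices F} \<and> v \<in> end_vertices F. x $ v)"
    by (rule sum.swap_restrict) auto
  also have "\<dots> = (\<Sum>v\<in>UNIV. real (card {F \<in> P. u \<in> end_vertices F \<and> v \<in> end_vertices F}) * x $ v)"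
    by (simp add: conj_assoc)
  also have "\<dots> = (adjacency_matrix E *v x) $ u + real (clique_degree P u) * x $ u"
    unfolding entry
    by (simp add: matrix_vector_mult_def distrib_right sum.distrib if_distrib[of "\<lambda>c. c * _"] cong: if_cong)
  finally show ?thesis
    by simp
qed

text \<open>Pairing \<open>x\<close> with \<open>N N\<^sup>T x\<close> gives the squared norm of
  \<open>N\<^sup>T x\<close>, whose coordinates are the clique sums.\<close>

lemma adjacency_quadratic_form:
  fixes E :: "'v::finite set set" and x :: "real ^ 'v"
  assumes "simple_graph E" and "edge_clique_partition E P"
  shows "x \<bullet> (adjacency_matrix E *v x) =
    (\<Sum>F\<in>P. (clique_sum x F)\<^sup>2) - (\<Sum>v\<in>UNIV. real (clique_degree P v) * (x $ v)\<^sup>2)"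
proof -
  have "x \<bullet> (adjacency_matrix E *v x) =
      (\<Sum>u\<in>UNIV. \<Sum>F | F \<in> P \<and> u \<in> end_vertices F. x $ u * clique_sum x F)
      - (\<Sum>v\<in>UNIV. real (clique_degree P v) * (x $ v)\<^sup>2)"
    by (simp add: inner_vec_def adjacency_matrix_mult_vec[OF assms] right_diff_distrib
        sum_subtractf sum_distrib_left power2_eq_square ac_simps)
  also have "(\<Sum>u\<in>UNIV. \<Sum>F | F \<in> P \<and> u \<in> end_vertices F. x $ u * clique_sum x F) =
      (\<Sum>F\<in>P. \<Sum>u | u \<in> UNIV \<and> u \<in> end_vertices F. x $ u * clique_sum x F)"
    by (rule sum.swap_restrict) auto
  also have "\<dots> = (\<Sum>F\<in>P. (clique_sum x F)\<^sup>2)"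
    by (simp add: power2_eq_square sum_distrib_right)
  finally show ?thesis .
qed

text \<open>The quadratic form equals \<open>\<mu> * (x \<bullet> x)\<close> at an eigenvector;
  adding \<open>c * (x \<bullet> x)\<close>, for an arbitrary shift \<open>c\<close>, moves the
  degrees into the coefficients \<open>c - m\<^sub>v\<close>.\<close>

lemma eigenvector_clique_identity:
  fixes E :: "'v::finite set set" and x :: "real ^ 'v"
  assumes "simple_graph E" and "edge_clique_partition E P"
    and "eigenvector (adjacency_matrix E) x \<mu>"
  shows "(\<mu> + c) * (x \<bullet> x) =
    (\<Sum>F\<in>P. (clique_sum x F)\<^sup>2) + (\<Sum>v\<in>UNIV. (c - real (clique_degree P v)) * (x $ v)\<^sup>2)"
proof -
  have "\<mu> * (x \<bullet> x) = x \<bullet> (adjacency_matrix E *v x)"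
    using assms(3) by (simp add: eigenvector_def)
  moreover have "c * (x \<bullet> x) = (\<Sum>v\<in>UNIV. c * (x $ v)\<^sup>2)"
    by (simp add: inner_vec_def sum_distrib_left power2_eq_square)
  ultimately show ?thesis
    by (simp add: adjacency_quadratic_form[OF assms(1,2)] distrib_right left_diff_distrib
        sum_subtractf)
qed

lemma clique_degree_le_max: "clique_degree P v \<le> max_clique_degree P"
  by (simp add: max_clique_degree_def)

theorem theorem3p1:
  fixes E :: "'v::finite set set" and P :: "'v set set set" and m :: nat
  assumes "simple_graph E"
    and "edge_clique_partition E P"
    and "m = max_clique_degree P"
  shows "(\<forall>\<mu>. eigenvalue (adjacency_matrix E) \<mu> \<longrightarrow> \<mu> \<ge> - real m) \<and>
    (eigenvalue (adjacency_matrix E) (- real m) \<longleftrightarrow>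
      (\<exists>X :: real ^ 'v. X \<noteq> 0 \<and>
        (\<forall>F\<in>P. (\<Sum>j\<in>end_vertices F. X $ j) = 0) \<and>
        (\<forall>v. clique_degree P v \<noteq> m \<longrightarrow> X $ v = 0))) \<and>
    (\<forall>X :: real ^ 'v. X \<noteq> 0 \<and>
        (\<forall>F\<in>P. (\<Sum>j\<in>end_vertices F. X $ j) = 0) \<and>
        (\<forall>v. clique_degree P v \<noteq> m \<longrightarrow> X $ v = 0) \<longrightarrow>
      eigenvector (adjacency_matrix E) X (- real m))"
proof -
  let ?A = "adjacency_matrix E"
  let ?cond = "\<lambda>X :: real ^ 'v. (\<forall>F\<in>P. clique_sum X F = 0) \<and>
    (\<forall>v. clique_degree P v \<noteq> m \<longrightarrow> X $ v = 0)"
  have deg: "clique_degree P v \<le> m" for v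
    using clique_degree_le_max assms(3) by blast
  \<comment> \<open>The shift \<open>c = m\<close> makes every coefficient
    \<open>m - m\<^sub>v\<close> nonnegative.\<close>
  note ident = eigenvector_clique_identity[OF assms(1,2), of _ _ "real m"]
  have nonneg: "0 \<le> (\<Sum>F\<in>P. (clique_sum x F)\<^sup>2)"
      "0 \<le> (\<Sum>v\<in>UNIV. (real m - real (clique_degree P v)) * (x $ v)\<^sup>2)" for x :: "real ^ 'v"
    by (auto intro!: sum_nonneg mult_nonneg_nonneg simp: deg)
  have lower: "\<mu> \<ge> - real m" if "eigenvector ?A x \<mu>" for x \<mu>
  proof -
    have "0 \<le> (\<mu> + real m) * (x \<bullet> x)"
      using ident[OF that] nonneg[of x] by simp
    moreover have "x \<bullet> x > 0"
      using that by (simp add: eigenvector_def)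
    ultimately show ?thesis
      by (simp add: zero_le_mult_iff)
  qed
  have necessary: "?cond x" if "eigenvector ?A x (- real m)" for x
  proof -
    have "(\<Sum>F\<in>P. (clique_sum x F)\<^sup>2) = 0"
      and "(\<Sum>v\<in>UNIV. (real m - real (clique_degree P v)) * (x $ v)\<^sup>2) = 0"
      using ident[OF that] nonneg[of x] by simp_all
    \<comment> \<open>All summands are nonnegative, so each one vanishes: every clique sum is 0, and
      \<open>x $ v\<close> is 0 wherever \<open>m - m\<^sub>v\<close> is not.\<close>
    then show ?thesis
      by (auto simp: sum_nonneg_eq_0_iff deg)
  qed
  have sufficient: "eigenvector ?A x (- real m)" if "x \<noteq> 0" "?cond x" for x
  proof -
    have "(?A *v x) $ u = (- real m *\<^sub>R x) $ u" for u
    proof -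
      \<comment> \<open>Condition (a) removes every clique sum, leaving only the diagonal
        term.\<close>
      have "(?A *v x) $ u = - (real (clique_degree P u) * x $ u)"
        using that by (simp add: adjacency_matrix_mult_vec[OF assms(1,2)])
      then show ?thesis
        \<comment> \<open>If the degree at \<open>u\<close> is not \<open>m\<close>, condition (b)
          gives \<open>x $ u = 0\<close> and both sides are 0.\<close>
        using that by (cases "clique_degree P u = m") auto
    qed
    then show ?thesis
      using that(1) by (simp add: eigenvector_def vec_eq_iff)
  qed
  show ?thesis
  proof (intro conjI iffI allI impI)
    fix \<mu>
    assume "eigenvalue ?A \<mu>"
    then show "\<mu> \<ge> - real m"
      unfolding eigenvalue_def using lower by blast
  next
    assume "eigenvalue ?A (- real m)"
    then obtain x where x: "eigenvector ?A x (- real m)"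
      unfolding eigenvalue_def by blast
    then have "x \<noteq> 0"
      by (simp add: eigenvector_def)
    with necessary[OF x] show "\<exists>x. x \<noteq> 0 \<and> ?cond x"
      by blast
  next
    assume "\<exists>x. x \<noteq> 0 \<and> ?cond x"
    then show "eigenvalue ?A (- real m)"
      unfolding eigenvalue_def using sufficient by blast
  next
    fix x
    assume "x \<noteq> 0 \<and> ?cond x"
    then show "eigenvector ?A x (- real m)"
      using sufficient by blast
  qed
qed

end
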